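(* The set $\mathcal{N}=\Gamma_A\cup\Gamma_B\cup\Gamma_C\cup\Gamma_{A_1}\cup\Gamma_{B_1}\cup\Gamma_{C_1}$ is the nucleus of the self-similar group $\Gamma$, where $$\Gamma_A=\langle\beta,\gamma,b,c\rangle,\quad \Gamma_B=\langle\alpha,\gamma,a,c\rangle,\quad \Gamma_C=\langle\alpha,\beta,a,b\rangle,$$ $$\Gamma_{A_1}=\langle\alpha,b,c\rangle,\quad \Gamma_{B_1}=\langle\beta,a,c\gamma\rangle,\quad \Gamma_{C_1}=\langle\gamma,a\alpha,b\beta\rangle.$$
   Context: Let $\mathsf{X}=\{1,2,3,4\}$ and let $\mathsf{X}^*$ be the rooted tree of finite words over $\mathsf{X}$ ($v$ is joined to $vx$). For a permutation $\tau$ of $\mathsf{X}$ and automorphisms $g_1,\dots,g_4$ of $\mathsf{X}^*$, $\tau(g_1,g_2,g_3,g_4)$ denotes the automorphism $xv\mapsto\tau(x)g_x(v)$; $\tau$ is omitted if trivial, the tuple is omitted if all $g_i$ are trivial. Actions are left actions ($gh$: first $h$), $\varepsilon$ is the identity. Sections: $g(xv)=g(x)\,g|_x(v)$ and $g|_{xv}=g|_x|_v$. Let $\sigma=(1\,2)(3\,4)$, $\pi=(1\,3)(2\,4)$. $\Gamma$ is the group generated by the automorphisms $$\alpha=\sigma,\quad a=\pi,\quad \beta=(\alpha,\gamma,\alpha,\gamma),\quad b=(a\alpha,a\alpha,c,c),\quad \gamma=(\beta,\varepsilon,\varepsilon,\beta),\quad c=(b\beta,b\beta,b,b).$$ The nucleus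 of a contracting self-similar group $G$ is the smallest set $\mathcal{N}\subset G$ such that for every $g\in G$ there is $n_0$ with $g|_v\in\mathcal{N}$ for all words $v$ of length at least $n_0$; $G$ is contracting if a finite set with this property exists. (The six groups listed are finite.) *)

theory Defs
  imports "HOL-Algebra.Generated_Groups" "HOL-Combinatorics.Transposition"
begin

definition tree_edge :: "'x list \<Rightarrow> 'x list \<Rightarrow> bool" where
  "tree_edge v w \<longleftrightarrow> (\<exists>x. w = v @ [x] \<or> v = w @ [x])"

text \<open>Left actions: the product \<open>g h\<close> applies \<open>h\<close> first.\<close>

definition tree_aut :: "('x list \<Rightarrow> 'x list) monoid" where
  "tree_aut = \<lparr>carrier = {g. bij g \<and> g [] = [] \<and>
                  (\<forall>v w. tree_edge (g v) (g w) \<longleftrightarrow> tree_edge v w)},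
               mult = (\<circ>), one = id\<rparr>"

text \<open>For an automorphism \<open>g\<close> the first letter of \<open>g (x # w)\<close> is that of \<open>g [x]\<close>, so the
  one-letter section of \<open>g\<close> is obtained by dropping it; see \<open>tree_aut_section\<close> below.\<close>

primrec tree_section :: "('x list \<Rightarrow> 'x list) \<Rightarrow> 'x list \<Rightarrow> 'x list \<Rightarrow> 'x list" where
  "tree_section g [] = g"
| "tree_section g (x # v) = tree_section (\<lambda>w. tl (g (x # w))) v"

lemma tree_aut_length:
  assumes "g \<in> carrier tree_aut"
  shows "length (g v) = length v"
proof (induction "length v" arbitrary: v rule: less_induct)
  case less
  have inj: "inj g" and g0: "g [] = []"
    and ed: "\<And>v w. tree_edge (g v) (g w) \<longleftrightarrow> tree_edge v w"
    using assms by (auto simp: tree_aut_def bij_def)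
  show ?case
  proof (cases v rule: rev_cases)
    case Nil
    then show ?thesis using g0 by simp
  next
    case (snoc u x)
    have lu: "length (g u) = length u" using less snoc by simp
    have "tree_edge (g u) (g v)" using ed snoc by (auto simp: tree_edge_def)
    then consider y where "g v = g u @ [y]" | y where "g u = g v @ [y]"
      by (auto simp: tree_edge_def)
    then show ?thesis
    proof cases
      case 1
      then show ?thesis using lu snoc by simp
    next
      case (2 y)
      then have "u \<noteq> []" using g0 by auto
      then obtain t z where u: "u = t @ [z]" by (metis rev_exhaust)
      have lt: "length (g t) = length t" using less snoc u by simp
      have "tree_edge (g t) (g u)" using ed u by (auto simp: tree_edge_def)
      then obtain y' where "g u = g t @ [y']" using lt lu u by (auto simp: tree_edge_def)
      then have "g t = g v" using 2 by simp
      then have "t = v" using inj by (simp add: inj_eq)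
      then show ?thesis using u snoc by simp
    qed
  qed
qed

lemma tree_aut_section:
  assumes "g \<in> carrier tree_aut"
  shows "g (x # v) = g [x] @ tree_section g [x] v"
proof (induction v rule: rev_induct)
  case Nil
  have "length (g [x]) = 1" using tree_aut_length[OF assms] by simp
  then show ?case by (cases "g [x]") auto
next
  case (snoc y v)
  have "tree_edge (g (x # v)) (g (x # v @ [y]))"
    using assms by (auto simp: tree_aut_def tree_edge_def)
  then obtain z where z: "g (x # v @ [y]) = g (x # v) @ [z]"
    using tree_aut_length[OF assms, of "x # v"] tree_aut_length[OF assms, of "x # v @ [y]"]
    by (auto simp: tree_edge_def)
  have "length (g [x]) = 1" using tree_aut_length[OF assms] by simp
  then obtain w where "g [x] = [w]" by (cases "g [x]") auto
  then show ?case using snoc z by (cases "g (x # v)") auto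
qed

definition self_similar :: "('x list \<Rightarrow> 'x list) set \<Rightarrow> bool" where
  "self_similar G \<longleftrightarrow> subgroup G tree_aut \<and> (\<forall>g\<in>G. \<forall>v. tree_section g v \<in> G)"

definition absorbing :: "('x list \<Rightarrow> 'x list) set \<Rightarrow> ('x list \<Rightarrow> 'x list) set \<Rightarrow> bool" where
  "absorbing G N \<longleftrightarrow> N \<subseteq> G \<and> (\<forall>g\<in>G. \<exists>n0. \<forall>v. length v \<ge> n0 \<longrightarrow> tree_section g v \<in> N)"

definition contracting :: "('x list \<Rightarrow> 'x list) set \<Rightarrow> bool" where
  "contracting G \<longleftrightarrow> self_similar G \<and> (\<exists>N. finite N \<and> absorbing G N)"

definition is_nucleus :: "('x list \<Rightarrow> 'x list) set \<Rightarrow> ('x list \<Rightarrow> 'x list) set \<Rightarrow> bool" where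
  "is_nucleus G N \<longleftrightarrow> contracting G \<and> absorbing G N \<and> (\<forall>N'. absorbing G N' \<longrightarrow> N \<subseteq> N')"

datatype letter = X1 | X2 | X3 | X4

type_synonym word = "letter list"

text \<open>\<open>wreath \<tau> g1 g2 g3 g4\<close> is \<open>\<tau>(g1, g2, g3, g4)\<close>.\<close>

fun wreath :: "(letter \<Rightarrow> letter) \<Rightarrow> (word \<Rightarrow> word) \<Rightarrow> (word \<Rightarrow> word) \<Rightarrow> (word \<Rightarrow> word) \<Rightarrow>
    (word \<Rightarrow> word) \<Rightarrow> word \<Rightarrow> word" where
  "wreath \<tau> g1 g2 g3 g4 [] = []"
| "wreath \<tau> g1 g2 g3 g4 (x # v) =
     \<tau> x # (case x of X1 \<Rightarrow> g1 v | X2 \<Rightarrow> g2 v | X3 \<Rightarrow> g3 v | X4 \<Rightarrow> g4 v)"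

definition perm_\<sigma> :: "letter \<Rightarrow> letter" where
  "perm_\<sigma> = transpose X1 X2 \<circ> transpose X3 X4"

definition perm_\<pi> :: "letter \<Rightarrow> letter" where
  "perm_\<pi> = transpose X1 X3 \<circ> transpose X2 X4"

definition gen_\<alpha> :: "word \<Rightarrow> word" where
  "gen_\<alpha> = wreath perm_\<sigma> id id id id"

definition gen_a :: "word \<Rightarrow> word" where
  "gen_a = wreath perm_\<pi> id id id id"

text \<open>The remaining generators are defined by recursion on words, first \<open>\<beta>, \<gamma>\<close> and then
  \<open>b, c\<close>; the lemmas \<open>gen_\<beta>_wreath\<close>, \<open>gen_\<gamma>_wreath\<close>, \<open>gen_b_wreath\<close> and \<open>gen_c_wreath\<close> below
  are their wreath recursions.\<close>

fun gen_\<beta> :: "word \<Rightarrow> word" and gen_\<gamma> :: "word \<Rightarrow> word" where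
  "gen_\<beta> [] = []"
| "gen_\<beta> (X1 # v) = X1 # gen_\<alpha> v"
| "gen_\<beta> (X2 # v) = X2 # gen_\<gamma> v"
| "gen_\<beta> (X3 # v) = X3 # gen_\<alpha> v"
| "gen_\<beta> (X4 # v) = X4 # gen_\<gamma> v"
| "gen_\<gamma> [] = []"
| "gen_\<gamma> (X1 # v) = X1 # gen_\<beta> v"
| "gen_\<gamma> (X2 # v) = X2 # v"
| "gen_\<gamma> (X3 # v) = X3 # v"
| "gen_\<gamma> (X4 # v) = X4 # gen_\<beta> v"

lemma length_gen_\<alpha>: "length (gen_\<alpha> v) = length v"
  by (cases v) (auto simp: gen_\<alpha>_def split: letter.split)

lemma length_gen_\<beta>: "length (gen_\<beta> v) = length v"
  and length_gen_\<gamma>: "length (gen_\<gamma> v) = length v"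
  by (induction v and v rule: gen_\<beta>_gen_\<gamma>.induct) (auto simp: length_gen_\<alpha>)

function gen_b :: "word \<Rightarrow> word" and gen_c :: "word \<Rightarrow> word" where
  "gen_b [] = []"
| "gen_b (X1 # v) = X1 # gen_a (gen_\<alpha> v)"
| "gen_b (X2 # v) = X2 # gen_a (gen_\<alpha> v)"
| "gen_b (X3 # v) = X3 # gen_c v"
| "gen_b (X4 # v) = X4 # gen_c v"
| "gen_c [] = []"
| "gen_c (X1 # v) = X1 # gen_b (gen_\<beta> v)"
| "gen_c (X2 # v) = X2 # gen_b (gen_\<beta> v)"
| "gen_c (X3 # v) = X3 # gen_b v"
| "gen_c (X4 # v) = X4 # gen_b v"
  by pat_completeness auto
termination
  by (relation "measure (\<lambda>s. case s of Inl v \<Rightarrow> length v | Inr v \<Rightarrow> length v)")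
    (auto simp: length_gen_\<beta>)

lemma gen_\<beta>_wreath: "gen_\<beta> = wreath id gen_\<alpha> gen_\<gamma> gen_\<alpha> gen_\<gamma>"
proof
  show "gen_\<beta> v = wreath id gen_\<alpha> gen_\<gamma> gen_\<alpha> gen_\<gamma> v" for v
    by (cases v rule: gen_\<beta>.cases) auto
qed

lemma gen_\<gamma>_wreath: "gen_\<gamma> = wreath id gen_\<beta> id id gen_\<beta>"
proof
  show "gen_\<gamma> v = wreath id gen_\<beta> id id gen_\<beta> v" for v
    by (cases v rule: gen_\<gamma>.cases) auto
qed

lemma gen_b_wreath: "gen_b = wreath id (gen_a \<circ> gen_\<alpha>) (gen_a \<circ> gen_\<alpha>) gen_c gen_c"
proof
  show "gen_b v = wreath id (gen_a \<circ> gen_\<alpha>) (gen_a \<circ> gen_\<alpha>) gen_c gen_c v" for v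
    by (cases v rule: gen_b.cases) auto
qed

lemma gen_c_wreath: "gen_c = wreath id (gen_b \<circ> gen_\<beta>) (gen_b \<circ> gen_\<beta>) gen_b gen_b"
proof
  show "gen_c v = wreath id (gen_b \<circ> gen_\<beta>) (gen_b \<circ> gen_\<beta>) gen_b gen_b v" for v
    by (cases v rule: gen_c.cases) auto
qed

definition Gamma :: "(word \<Rightarrow> word) set" where
  "Gamma = generate tree_aut {gen_\<alpha>, gen_a, gen_\<beta>, gen_b, gen_\<gamma>, gen_c}"

definition Gamma_A :: "(word \<Rightarrow> word) set" where
  "Gamma_A = generate tree_aut {gen_\<beta>, gen_\<gamma>, gen_b, gen_c}"

definition Gamma_B :: "(word \<Rightarrow> word) set" where
  "Gamma_B = generate tree_aut {gen_\<alpha>, gen_\<gamma>, gen_a, gen_c}"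

definition Gamma_C :: "(word \<Rightarrow> word) set" where
  "Gamma_C = generate tree_aut {gen_\<alpha>, gen_\<beta>, gen_a, gen_b}"

definition Gamma_A1 :: "(word \<Rightarrow> word) set" where
  "Gamma_A1 = generate tree_aut {gen_\<alpha>, gen_b, gen_c}"

definition Gamma_B1 :: "(word \<Rightarrow> word) set" where
  "Gamma_B1 = generate tree_aut {gen_\<beta>, gen_a, gen_c \<circ> gen_\<gamma>}"

definition Gamma_C1 :: "(word \<Rightarrow> word) set" where
  "Gamma_C1 = generate tree_aut {gen_\<gamma>, gen_a \<circ> gen_\<alpha>, gen_b \<circ> gen_\<beta>}"

end

(* All six groups are generated by involutions, and the one-letter sections of each of them lie
   in the six groups again: for instance Gamma_A fixes the first level, and its sections at 1, 2, 3, 4 are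
   Gamma_C, Gamma_C1, Gamma_A1 and Gamma_A.  Contraction is obtained by showing that the set of
   elements whose deep sections lie in the nucleus is closed under right multiplication by each
   generator; since b and c have sections a alpha, b beta, b and c, this is done for alpha and a, then
   for beta and gamma, then for b and c.  Conversely, every element of the nucleus is itself a
   section of an element of the nucleus, hence a section at arbitrarily deep words; together with
   finiteness this gives minimality.  Finiteness comes from dihedral groups: beta and gamma generate
   a finite dihedral group normalised by b and c, because b gamma b = beta gamma beta and
   c beta c = gamma beta gamma, and similarly for Gamma_B and Gamma_C. *)

theory Submission
  imports Defs
begin

section \<open>Evaluation of the generators on the first letter\<close>

lemma gen_\<alpha>_simps [simp]:
  "gen_\<alpha> [] = []"
  "gen_\<alpha> (X1 # v) = X2 # v" "gen_\<alpha> (X2 # v) = X1 # v"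
  "gen_\<alpha> (X3 # v) = X4 # v" "gen_\<alpha> (X4 # v) = X3 # v"
  by (simp_all add: gen_\<alpha>_def perm_\<sigma>_def)

lemma gen_a_simps [simp]:
  "gen_a [] = []"
  "gen_a (X1 # v) = X3 # v" "gen_a (X2 # v) = X4 # v"
  "gen_a (X3 # v) = X1 # v" "gen_a (X4 # v) = X2 # v"
  by (simp_all add: gen_a_def perm_\<pi>_def)

lemma word_cases:
  obtains "w = []" | v where "w = X1 # v" | v where "w = X2 # v"
    | v where "w = X3 # v" | v where "w = X4 # v"
  by (metis letter.exhaust list.exhaust)

lemma length_gen_a: "length (gen_a v) = length v"
  by (cases v rule: word_cases) auto

lemma length_gen_b: "length (gen_b v) = length v"
  and length_gen_c: "length (gen_c v) = length v"
  by (induction v and v rule: gen_b_gen_c.induct)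
    (auto simp: length_gen_\<alpha> length_gen_a length_gen_\<beta>)

lemmas length_gens =
  length_gen_\<alpha> length_gen_a length_gen_\<beta> length_gen_\<gamma> length_gen_b length_gen_c

section \<open>Relations between the generators\<close>

lemma gen_\<alpha>_involutive [simp]: "gen_\<alpha> (gen_\<alpha> v) = v"
  by (cases v rule: word_cases) auto

lemma gen_a_involutive [simp]: "gen_a (gen_a v) = v"
  by (cases v rule: word_cases) auto

lemma gen_\<beta>_involutive [simp]: "gen_\<beta> (gen_\<beta> v) = v"
  and gen_\<gamma>_involutive [simp]: "gen_\<gamma> (gen_\<gamma> v) = v"
  by (induction v and v rule: gen_\<beta>_gen_\<gamma>.induct) auto

lemma commute_\<alpha>a: "gen_\<alpha> (gen_a v) = gen_a (gen_\<alpha> v)"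
  by (cases v rule: word_cases) auto

text \<open>a exchanges 1 with 3 and 2 with 4, and \<beta> has equal sections at exchanged letters.
  Several commutation rules rest on such a coincidence: sections of \<gamma> agree on the orbits of
  a\<alpha>, and those of b and c on the orbits of \<alpha>.\<close>

lemma commute_\<beta>a: "gen_\<beta> (gen_a v) = gen_a (gen_\<beta> v)"
  by (cases v rule: word_cases) auto

lemma commute_\<gamma>a\<alpha>: "gen_\<gamma> (gen_a (gen_\<alpha> v)) = gen_a (gen_\<alpha> (gen_\<gamma> v))"
  by (cases v rule: word_cases) auto

text \<open>Both a\<gamma>a and \<alpha>\<gamma>\<alpha> move the two sections \<beta> of \<gamma>
  from the letters 1, 4 to 2, 3.\<close>

lemma conj_\<gamma>a: "gen_\<gamma> (gen_a v) = gen_a (gen_\<alpha> (gen_\<gamma> (gen_\<alpha> v)))"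
  by (cases v rule: word_cases) auto

lemma commute_\<alpha>b: "gen_\<alpha> (gen_b v) = gen_b (gen_\<alpha> v)"
  by (cases v rule: word_cases) auto

lemma commute_\<alpha>c: "gen_\<alpha> (gen_c v) = gen_c (gen_\<alpha> v)"
  by (cases v rule: word_cases) auto

text \<open>The two rules are proved together: at the letter 4 the first reduces to \<gamma>
  commuting with c, and at 1 and 4 the second reduces to \<beta> commuting with b.\<close>

lemma commute_\<beta>b_\<gamma>c: "gen_\<beta> (gen_b v) = gen_b (gen_\<beta> v) \<and> gen_\<gamma> (gen_c v) = gen_c (gen_\<gamma> v)"
  by (induction v rule: length_induct, rule_tac w = xs in word_cases)
    (auto simp: commute_\<alpha>a commute_\<gamma>a\<alpha> commute_\<alpha>c length_gens)

lemmas commute_\<beta>b = commute_\<beta>b_\<gamma>c [THEN conjunct1]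
lemmas commute_\<gamma>c = commute_\<beta>b_\<gamma>c [THEN conjunct2]

text \<open>The square of b has sections (a\<alpha>)^2 and c^2, and that of c has (b\<beta>)^2 and
  b^2; since \<beta> commutes with b, (b\<beta>)^2 is b^2 and the simultaneous induction
  closes.\<close>

lemma gen_bc_involutive: "gen_b (gen_b v) = v \<and> gen_c (gen_c v) = v"
  by (induction v rule: length_induct, rule_tac w = xs in word_cases)
    (auto simp: commute_\<alpha>a commute_\<beta>b length_gens)

lemmas gen_b_involutive [simp] = gen_bc_involutive [THEN conjunct1]
lemmas gen_c_involutive [simp] = gen_bc_involutive [THEN conjunct2]

text \<open>Each of the two identities at a word needs the other one at its tail.\<close>

lemma conj_b\<gamma>_c\<beta>: "gen_b (gen_\<gamma> (gen_b v)) = gen_\<beta> (gen_\<gamma> (gen_\<beta> v)) \<and>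
    gen_c (gen_\<beta> (gen_c v)) = gen_\<gamma> (gen_\<beta> (gen_\<gamma> v))"
proof (induction v rule: length_induct)
  case (1 v)
  have [simp]: "gen_\<alpha> (gen_\<beta> (gen_a w)) = gen_a (gen_\<alpha> (gen_\<beta> w))" for w
    by (simp add: commute_\<alpha>a commute_\<beta>a)
  have [simp]: "gen_b (gen_\<alpha> (gen_b w)) = gen_\<alpha> w" for w
    by (simp flip: commute_\<alpha>b)
  have [simp]: "gen_b (gen_\<beta> (gen_\<alpha> (gen_b w))) = gen_\<beta> (gen_\<alpha> w)" for w
    by (simp add: commute_\<alpha>b commute_\<beta>b)
  have [simp]: "gen_a (gen_\<alpha> (gen_a (gen_\<alpha> w))) = w" for w
    by (simp add: commute_\<alpha>a)
  \<comment> \<open>The section of c\<beta>c at 2 is b\<beta>\<gamma>b\<beta>, while that of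
    \<gamma>\<beta>\<gamma> is \<gamma>. Their equality is the induction hypothesis for b\<gamma>b,
    conjugated by \<beta>.\<close>
  have [simp]: "gen_b (gen_\<beta> (gen_\<gamma> (gen_b (gen_\<beta> w)))) = gen_\<gamma> w"
    if "length w < length v" for w
  proof -
    have "gen_b (gen_\<gamma> (gen_b (gen_b w))) = gen_\<beta> (gen_\<gamma> (gen_\<beta> (gen_b w)))"
      using 1 that by (simp only: length_gens)
    then have "gen_b (gen_\<gamma> w) = gen_\<beta> (gen_\<gamma> (gen_\<beta> (gen_b w)))" by simp
    then show ?thesis by (metis commute_\<beta>b gen_b_involutive)
  qed
  show ?case using 1
    by (cases v rule: word_cases) (auto simp: commute_\<beta>b length_gens)
qed

lemma conj_b\<gamma>: "gen_b (gen_\<gamma> v) = gen_\<beta> (gen_\<gamma> (gen_\<beta> (gen_b v)))"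
  using conj_b\<gamma>_c\<beta>[of "gen_b v"] by simp

lemma conj_c\<beta>: "gen_c (gen_\<beta> v) = gen_\<gamma> (gen_\<beta> (gen_\<gamma> (gen_c v)))"
  using conj_b\<gamma>_c\<beta>[of "gen_c v"] by simp

text \<open>c\<gamma> has section b at 1 and 3 and b\<beta> at 2 and 4, the orbits of a. This and
  the next two rules are what makes \<open>Gamma_B1\<close> and \<open>Gamma_C1\<close>
  finite.\<close>

lemma commute_c\<gamma>a: "gen_c (gen_\<gamma> (gen_a v)) = gen_a (gen_c (gen_\<gamma> v))"
  by (cases v rule: word_cases) (auto simp: commute_\<beta>b)

lemma commute_c\<gamma>\<beta>: "gen_c (gen_\<gamma> (gen_\<beta> v)) = gen_\<beta> (gen_c (gen_\<gamma> v))"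
  by (simp add: conj_c\<beta> flip: commute_\<gamma>c)

lemma commute_b\<beta>\<gamma>: "gen_b (gen_\<beta> (gen_\<gamma> v)) = gen_\<gamma> (gen_b (gen_\<beta> v))"
  by (simp add: conj_b\<gamma> flip: commute_\<beta>b)

text \<open>The square of \<alpha>\<gamma> fixes the first letter and has section \<beta> at every
  letter, so the fourth power is trivial.\<close>

lemma order_\<alpha>\<gamma>: "gen_\<alpha> (gen_\<gamma> (gen_\<alpha> (gen_\<gamma> (gen_\<alpha> (gen_\<gamma> (gen_\<alpha> (gen_\<gamma> v))))))) = v"
  by (cases v rule: word_cases) auto

lemma order_\<gamma>\<alpha>: "gen_\<gamma> (gen_\<alpha> (gen_\<gamma> (gen_\<alpha> (gen_\<gamma> (gen_\<alpha> (gen_\<gamma> (gen_\<alpha> v))))))) = v"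
  by (cases v rule: word_cases) auto

lemma pow_\<alpha>\<gamma>: "((gen_\<alpha> \<circ> gen_\<gamma>) ^^ 4) v = v"
  by (simp add: eval_nat_numeral order_\<alpha>\<gamma>)

text \<open>The sections of (\<alpha>\<beta>)^2 are \<gamma>\<alpha> and \<alpha>\<gamma>, whose
  fourth powers are trivial.\<close>

lemma pow_\<alpha>\<beta>: "((gen_\<alpha> \<circ> gen_\<beta>) ^^ 8) v = v"
  by (cases v rule: word_cases) (auto simp: eval_nat_numeral order_\<alpha>\<gamma> order_\<gamma>\<alpha>)

lemma pow_\<beta>\<alpha>: "((gen_\<beta> \<circ> gen_\<alpha>) ^^ 8) v = v"
  by (cases v rule: word_cases) (auto simp: eval_nat_numeral order_\<alpha>\<gamma> order_\<gamma>\<alpha>)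

text \<open>\<beta>\<gamma> fixes the first letter, with sections \<alpha>\<beta>, \<gamma>,
  \<alpha>, \<gamma>\<beta>. The last one is the reversed product, so both orders go through the
  induction together.\<close>

lemma pow_\<beta>\<gamma>_\<gamma>\<beta>: "((gen_\<beta> \<circ> gen_\<gamma>) ^^ 8) v = v \<and> ((gen_\<gamma> \<circ> gen_\<beta>) ^^ 8) v = v"
proof (induction v rule: length_induct)
  case (1 v)
  show ?case using 1 pow_\<alpha>\<beta> pow_\<beta>\<alpha>
    by (cases v rule: word_cases) (auto simp: eval_nat_numeral)
qed

text \<open>Again the square has section \<beta> at every letter, the product of b and b\<beta> in
  either order.\<close>

lemma pow_ac: "((gen_a \<circ> gen_c) ^^ 4) v = v"
  by (cases v rule: word_cases) (auto simp: eval_nat_numeral commute_\<beta>b)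

lemma pow_ab: "((gen_a \<circ> gen_b) ^^ 8) v = v"
proof -
  \<comment> \<open>(ab)^2 has sections ca\<alpha> and a\<alpha>c. Their squares have section
    \<beta> at every letter, so their fourth powers are trivial.\<close>
  have [simp]: "gen_c (gen_a (gen_\<alpha> (gen_c (gen_a (gen_\<alpha> (gen_c (gen_a (gen_\<alpha>
    (gen_c (gen_a (gen_\<alpha> w))))))))))) = w" for w
    by (cases w rule: word_cases) (auto simp: commute_\<beta>b)
  have [simp]: "gen_a (gen_\<alpha> (gen_c (gen_a (gen_\<alpha> (gen_c (gen_a (gen_\<alpha>
    (gen_c (gen_a (gen_\<alpha> (gen_c w))))))))))) = w" for w
    by (cases w rule: word_cases) (auto simp: commute_\<beta>b)
  show ?thesis
    by (cases v rule: word_cases) (auto simp: eval_nat_numeral)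
qed

lemma pow_bc: "((gen_b \<circ> gen_c) ^^ 4) v = v"
proof -
  \<comment> \<open>bc fixes the first letter and has sections a\<alpha>b\<beta> at 1, 2 and cb at
    3, 4. For cb the induction hypothesis has to be read in reversed order.\<close>
  have [simp]: "gen_b (gen_c (gen_b (gen_c (gen_b (gen_c (gen_b (gen_c w))))))) = w \<Longrightarrow>
    gen_c (gen_b (gen_c (gen_b (gen_c (gen_b (gen_c (gen_b w))))))) = w" for w
    by (metis gen_b_involutive gen_c_involutive)
  have [simp]: "gen_c (gen_\<gamma> (gen_c (gen_\<gamma> w))) = w" for w
    by (simp add: commute_\<gamma>c)
  have [simp]: "gen_c (gen_\<alpha> (gen_a (gen_\<alpha> (gen_\<gamma> (gen_c (gen_\<alpha> (gen_a (gen_\<alpha> (gen_\<gamma> w))))))))) = w" for w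
    by (cases w rule: word_cases) (auto simp: commute_\<beta>b)
  have [simp]: "gen_a (gen_\<alpha> (gen_\<gamma> (gen_c (gen_\<alpha> (gen_a (gen_\<alpha> (gen_\<gamma> (gen_c (gen_\<alpha> w))))))))) = w" for w
    by (cases w rule: word_cases) (auto simp: commute_\<beta>b)
  \<comment> \<open>The square of a\<alpha>b\<beta> fixes the first letter. Its sections at 1 and 4
    are products of the commuting involutions a and c\<gamma>; those at 2 and 3 are the words whose
    squares were just shown to be trivial.\<close>
  have [simp]: "gen_a (gen_\<alpha> (gen_b (gen_\<beta> (gen_a (gen_\<alpha> (gen_b (gen_\<beta>
    (gen_a (gen_\<alpha> (gen_b (gen_\<beta> (gen_a (gen_\<alpha> (gen_b (gen_\<beta> w))))))))))))))) = w" for w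
    by (cases w rule: word_cases) (auto simp: commute_\<beta>b commute_c\<gamma>a commute_\<gamma>a\<alpha>)
  show ?thesis
    by (induction v rule: length_induct, rule_tac w = xs in word_cases) (auto simp: eval_nat_numeral)
qed

section \<open>Groups generated by involutions\<close>

lemma group_tree_aut: "group (tree_aut :: ('x list \<Rightarrow> 'x list) monoid)"
proof (rule groupI)
  fix g :: "'x list \<Rightarrow> 'x list" assume g: "g \<in> carrier tree_aut"
  then have "bij g" by (simp add: tree_aut_def)
  moreover have "tree_edge (inv_into UNIV g v) (inv_into UNIV g w) \<longleftrightarrow> tree_edge v w" for v w
    using g \<open>bij g\<close> surj_f_inv_f[of g]
    by (metis (mono_tags, lifting) CollectD bij_is_surj partial_object.select_convs(1) tree_aut_def)
  moreover have "inv_into UNIV g [] = []"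
    using g \<open>bij g\<close>
    by (metis (mono_tags, lifting) CollectD bij_inv_eq_iff partial_object.select_convs(1) tree_aut_def)
  ultimately have "inv_into UNIV g \<in> carrier tree_aut"
    by (simp add: tree_aut_def bij_imp_bij_inv)
  moreover have "inv_into UNIV g \<circ> g = id" using \<open>bij g\<close> by (simp add: bij_is_inj)
  ultimately show "\<exists>h\<in>carrier tree_aut. h \<otimes>\<^bsub>tree_aut\<^esub> g = \<one>\<^bsub>tree_aut\<^esub>"
    by (auto simp: tree_aut_def)
qed (auto simp: tree_aut_def bij_comp)

definition involutions :: "('x list \<Rightarrow> 'x list) set" where
  "involutions = {g \<in> carrier tree_aut. g \<circ> g = id}"

abbreviation generated :: "('x list \<Rightarrow> 'x list) set \<Rightarrow> ('x list \<Rightarrow> 'x list) set" where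
  "generated S \<equiv> generate tree_aut S"

lemma tree_aut_mult [simp]: "g \<otimes>\<^bsub>tree_aut\<^esub> h = g \<circ> h"
  by (simp add: tree_aut_def)

lemma tree_aut_one [simp]: "\<one>\<^bsub>tree_aut\<^esub> = id"
  by (simp add: tree_aut_def)

lemma generated_id [simp]: "id \<in> generated S"
  using generate.one[of tree_aut S] by (simp add: tree_aut_def)

lemma generated_comp:
  assumes "g \<in> generated S" "h \<in> generated S"
  shows "g \<circ> h \<in> generated S"
  using generate.eng[OF assms] by (simp add: tree_aut_def)

lemma generated_carrier:
  assumes "S \<subseteq> involutions" "g \<in> generated S"
  shows "g \<in> carrier tree_aut"
  using group.generate_in_carrier[OF group_tree_aut, of S g] assms by (auto simp: involutions_def)

lemma generated_subset_generated:
  assumes "S \<subseteq> generated T" "T \<subseteq> involutions"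
  shows "generated S \<subseteq> generated T"
proof (rule group.generate_subgroup_incl[OF group_tree_aut assms(1)])
  show "subgroup (generated T) tree_aut"
    using group.generate_is_subgroup[OF group_tree_aut] assms(2) by (auto simp: involutions_def)
qed

text \<open>Generators that are involutions are their own inverses, so left multiplication by
  generators reaches the whole group.\<close>

lemma generated_induct [consumes 2, case_names id comp]:
  assumes S: "S \<subseteq> involutions" and "g \<in> generated S"
    and P: "P id" "\<And>s h. s \<in> S \<Longrightarrow> h \<in> generated S \<Longrightarrow> P h \<Longrightarrow> P (s \<circ> h)"
  shows "P g"
proof -
  interpret group "tree_aut :: ('a list \<Rightarrow> 'a list) monoid" by (rule group_tree_aut)
  \<comment> \<open>Generalising over a right factor lets the product case of
    \<open>generate.induct\<close> apply one induction hypothesis after the other.\<close>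
  have "P (g \<circ> h)" if "h \<in> generated S" "P h" for h
    using assms(2) that
  proof (induction arbitrary: h rule: generate.induct)
    case one
    then show ?case by simp
  next
    case (incl s)
    then show ?case using P(2) by blast
  next
    case (inv s)
    then have "s \<in> carrier tree_aut" "s \<circ> s = id" using S by (auto simp: involutions_def)
    then have "inv\<^bsub>tree_aut\<^esub> s = s"
      by (intro inv_equality) simp_all
    then show ?case using P(2)[OF inv] by metis
  next
    case (eng g h k)
    then have "P (g \<circ> (h \<circ> k))" using generated_comp by blast
    then show ?case by (metis comp_assoc tree_aut_mult)
  qed
  from this[OF generated_id P(1)] show ?thesis by simp
qed

text \<open>The group is dihedral: its elements are the powers of xy and their left multiples by y,
  and powers repeat modulo n.\<close>

lemma finite_generated_pair:
  assumes xy: "x \<in> involutions" "y \<in> involutions"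
    and pow: "(x \<circ> y) ^^ n = id" "n > 0"
  shows "finite (generated {x, y})"
proof -
  have inv: "x \<circ> x = id" "y \<circ> y = id" "{x, y} \<subseteq> involutions"
    using xy by (auto simp: involutions_def)
  define R where "R = range (\<lambda>i. (x \<circ> y) ^^ i)"
  have "(x \<circ> y) ^^ i \<in> (\<lambda>i. (x \<circ> y) ^^ i) ` {..<n}" for i
  proof
    show "(x \<circ> y) ^^ i = (x \<circ> y) ^^ (i mod n)"
      using funpow_mod_eq[of n "x \<circ> y"] pow(1) by (metis ext id_apply)
  qed (use pow(2) in auto)
  then have "R \<subseteq> (\<lambda>i. (x \<circ> y) ^^ i) ` {..<n}" by (auto simp: R_def)
  then have "finite R" using finite_surj by blast
  moreover have "g \<in> R \<union> (\<circ>) y ` R" if "g \<in> generated {x, y}" for g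
    using inv(3) that
  proof (induction rule: generated_induct)
    case id
    show ?case unfolding R_def by (metis UnI1 rangeI funpow.simps(1))
  next
    case (comp s h)
    have yy: "y \<circ> (y \<circ> f) = f" for f using inv(2) by (metis comp_assoc id_comp)
    have xx: "x \<circ> (x \<circ> f) = f" for f using inv(1) by (metis comp_assoc id_comp)
    \<comment> \<open>In effect x(xy)^i = y(xy)^(i-1). Inserting (xy)^n = id keeps the exponent a
      natural number when i = 0.\<close>
    have "x \<circ> (x \<circ> y) ^^ i \<in> (\<circ>) y ` R" for i
    proof
      have "(x \<circ> y) ^^ i = (x \<circ> y) ^^ n \<circ> (x \<circ> y) ^^ i" using pow by simp
      also have "\<dots> = (x \<circ> y) ^^ Suc (n - 1 + i)"
        using pow(2) by (simp flip: funpow_add add: Suc_pred')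
      finally show "x \<circ> (x \<circ> y) ^^ i = y \<circ> (x \<circ> y) ^^ (n - 1 + i)"
        by (simp add: xx comp_assoc)
    qed (auto simp: R_def)
    have "x \<circ> (y \<circ> (x \<circ> y) ^^ i) \<in> R" for i
    proof -
      have "x \<circ> (y \<circ> (x \<circ> y) ^^ i) = (x \<circ> y) ^^ Suc i" by (simp add: comp_assoc)
      then show ?thesis unfolding R_def by (metis rangeI)
    qed
    consider i where "h = (x \<circ> y) ^^ i" | i where "h = y \<circ> (x \<circ> y) ^^ i"
      using comp by (auto simp only: R_def)
    then show ?case
    proof cases
      case (1 i)
      then show ?thesis using comp(1) \<open>x \<circ> (x \<circ> y) ^^ i \<in> (\<circ>) y ` R\<close>
        by (metis R_def Un_iff imageI insert_iff rangeI singletonD)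
    next
      case (2 i)
      then show ?thesis using comp(1) yy \<open>x \<circ> (y \<circ> (x \<circ> y) ^^ i) \<in> R\<close>
        by (metis R_def Un_iff insert_iff rangeI singletonD)
    qed
  qed
  ultimately show ?thesis by (meson finite_UnI finite_imageI finite_subset subsetI)
qed

text \<open>T normalises the group generated by S, so every element of the joint group is a product
  of one element from each group.\<close>

lemma finite_generated_Un:
  assumes ST: "S \<subseteq> involutions" "T \<subseteq> involutions"
    and fin: "finite (generated S)" "finite (generated T)"
    and normalises: "\<And>s t. s \<in> S \<Longrightarrow> t \<in> T \<Longrightarrow> t \<circ> s \<circ> t \<in> generated S"
  shows "finite (generated (S \<union> T))"
proof -
  have conj: "t \<circ> d \<circ> t \<in> generated S" if "t \<in> T" "d \<in> generated S" for t d
    using ST(1) that(2)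
  proof (induction rule: generated_induct)
    case id
    then have "t \<circ> t = id" using ST(2) that(1) by (auto simp: involutions_def)
    then show ?case by (metis comp_id generated_id)
  next
    case (comp s h)
    have "t \<circ> (s \<circ> h) \<circ> t = (t \<circ> s \<circ> t) \<circ> (t \<circ> h \<circ> t)"
      using ST(2) that(1) by (auto simp: involutions_def fun_eq_iff)
    then show ?case using generated_comp normalises[OF comp(1) that(1)] comp by metis
  qed
  have "\<exists>d\<in>generated S. \<exists>k\<in>generated T. g = d \<circ> k" if "g \<in> generated (S \<union> T)" for g
    using Un_least[OF ST] that
  proof (induction rule: generated_induct)
    case id
    then show ?case by (metis comp_id generated_id)
  next
    case (comp s h)
    then obtain d k where h: "h = d \<circ> k" "d \<in> generated S" "k \<in> generated T" by blast
    show ?case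
    proof (cases "s \<in> S")
      case True
      then have "s \<circ> d \<in> generated S" using h generated_comp generate.incl by metis
      then show ?thesis using h by (metis comp_assoc)
    next
      case False
      then have s: "s \<in> T" using comp by blast
      then have "s \<circ> k \<in> generated T" using h generated_comp generate.incl by metis
      \<comment> \<open>A new factor from T is moved past d by conjugation.\<close>
      moreover have "s \<circ> h = (s \<circ> d \<circ> s) \<circ> (s \<circ> k)"
        using s ST(2) h(1) by (auto simp: involutions_def fun_eq_iff)
      ultimately show ?thesis using conj[OF s h(2)] by metis
    qed
  qed
  then have "generated (S \<union> T) \<subseteq> (\<lambda>(d, k). d \<circ> k) ` (generated S \<times> generated T)" by fast
  then show ?thesis using fin by (meson finite_SigmaI finite_imageI finite_subset)
qed

section \<open>Sections of products\<close>

definition letter_section :: "('x list \<Rightarrow> 'x list) \<Rightarrow> 'x \<Rightarrow> 'x list \<Rightarrow> 'x list" where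
  "letter_section g x v = tl (g (x # v))"

definition letter_action :: "('x list \<Rightarrow> 'x list) \<Rightarrow> 'x \<Rightarrow> 'x" where
  "letter_action g x = hd (g [x])"

lemma tree_section_Cons: "tree_section g (x # v) = tree_section (letter_section g x) v"
  by (simp add: letter_section_def [abs_def])

lemma tree_section_append: "tree_section g (u @ v) = tree_section (tree_section g u) v"
  by (induction u arbitrary: g) auto

lemma tree_aut_Cons:
  assumes "g \<in> carrier tree_aut"
  shows "g (x # v) = letter_action g x # letter_section g x v"
proof -
  have "length (g [x]) = 1" using tree_aut_length[OF assms] by simp
  then show ?thesis using tree_aut_section[OF assms, of x v]
    by (cases "g [x]") (auto simp: letter_action_def letter_section_def)
qed

lemma letter_action_id [simp]: "letter_action id x = x"
  by (simp add: letter_action_def)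

lemma letter_section_id [simp]: "letter_section id x = id"
  by (simp add: letter_section_def fun_eq_iff)

lemma letter_action_comp:
  assumes "g \<in> carrier tree_aut" "h \<in> carrier tree_aut"
  shows "letter_action (g \<circ> h) x = letter_action g (letter_action h x)"
proof -
  have "(g \<circ> h) [x] = letter_action g (letter_action h x) #
      letter_section g (letter_action h x) (letter_section h x [])"
    by (simp add: tree_aut_Cons assms)
  then show ?thesis by (simp add: letter_action_def)
qed

lemma letter_section_comp:
  assumes "g \<in> carrier tree_aut" "h \<in> carrier tree_aut"
  shows "letter_section (g \<circ> h) x = letter_section g (letter_action h x) \<circ> letter_section h x"
proof
  fix v
  show "letter_section (g \<circ> h) x v = (letter_section g (letter_action h x) \<circ> letter_section h x) v"
    using tree_aut_Cons[OF assms(1)] tree_aut_Cons[OF assms(2)]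
    by (simp add: letter_section_def)
qed

text \<open>The section of a product at x involves the section of the left factor at the image of x.
  Hence the letters considered must form a set \<open>Y\<close> invariant under the
  generators.\<close>

lemma generated_sections:
  assumes S: "S \<subseteq> involutions"
    and step: "\<And>s y. s \<in> S \<Longrightarrow> y \<in> Y \<Longrightarrow>
      letter_action s y \<in> Y \<and> letter_section s y \<in> generated T"
    and g: "g \<in> generated S" and x: "x \<in> Y"
  shows "letter_action g x \<in> Y \<and> letter_section g x \<in> generated T"
  using S g
proof (induction rule: generated_induct)
  case id
  then show ?case using x by (simp only: letter_action_id letter_section_id generated_id)
next
  case (comp s h)
  have "s \<in> carrier tree_aut" "h \<in> carrier tree_aut"
    using S comp generated_carrier[OF S] by (auto simp: involutions_def)
  then have "letter_action (s \<circ> h) x = letter_action s (letter_action h x)"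
    "letter_section (s \<circ> h) x = letter_section s (letter_action h x) \<circ> letter_section h x"
    by (rule letter_action_comp letter_section_comp)+
  then show ?case using step[OF comp(1), of "letter_action h x"] comp(3) by (metis generated_comp)
qed

text \<open>On the stabiliser of x, taking the section at x is a homomorphism, so it suffices to
  lift generators.\<close>

lemma generated_lift:
  assumes S: "S \<subseteq> involutions" and T: "T \<subseteq> involutions"
    and step: "\<And>t. t \<in> T \<Longrightarrow>
      \<exists>g\<in>generated S. letter_action g x = x \<and> letter_section g x = t"
    and h: "h \<in> generated T"
  shows "\<exists>g\<in>generated S. letter_action g x = x \<and> letter_section g x = h"
  using T h
proof (induction rule: generated_induct)
  case id
  show ?case
    by (intro bexI[of _ id] conjI letter_action_id letter_section_id generated_id)
next
  case (comp t h)
  obtain g where g: "g \<in> generated S" "letter_action g x = x" "letter_section g x = t"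
    using step comp(1) by blast
  obtain k where k: "k \<in> generated S" "letter_action k x = x" "letter_section k x = h"
    using comp by blast
  have "g \<circ> k \<in> generated S" using g k generated_comp by blast
  moreover have "letter_action (g \<circ> k) x = x" "letter_section (g \<circ> k) x = t \<circ> h"
    using g k generated_carrier[OF S] by (simp_all add: letter_action_comp letter_section_comp)
  ultimately show ?case by blast
qed

section \<open>Self-similarity and contraction\<close>

lemma take_gen_\<alpha>: "take n (gen_\<alpha> v) = gen_\<alpha> (take n v)"
  by (cases n; cases v rule: word_cases) auto

lemma take_gen_a: "take n (gen_a v) = gen_a (take n v)"
  by (cases n; cases v rule: word_cases) auto

lemma take_gen_\<beta>: "take n (gen_\<beta> v) = gen_\<beta> (take n v)"
  and take_gen_\<gamma>: "take n (gen_\<gamma> v) = gen_\<gamma> (take n v)"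
  by (induction v and v arbitrary: n and n rule: gen_\<beta>_gen_\<gamma>.induct)
    (case_tac n; simp add: take_gen_\<alpha>)+

lemma take_gen_b: "take n (gen_b v) = gen_b (take n v)"
  and take_gen_c: "take n (gen_c v) = gen_c (take n v)"
  by (induction v and v arbitrary: n and n rule: gen_b_gen_c.induct)
    (case_tac n; simp add: take_gen_\<alpha> take_gen_a take_gen_\<beta>)+

text \<open>Preserving lengths and prefixes sends a child of v to a child of the image of v, so
  edges go to edges; applying the involution again gives the converse.\<close>

lemma involutionI:
  assumes "\<And>v. g (g v) = v" "\<And>v. length (g v) = length v" "\<And>n v. take n (g v) = g (take n v)"
  shows "g \<in> involutions"
proof -
  have snoc: "\<exists>y. g (v @ [x]) = g v @ [y]" for v x
  proof -
    have "g (v @ [x]) = take (length v) (g (v @ [x])) @ drop (length v) (g (v @ [x]))" by simp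
    moreover have "take (length v) (g (v @ [x])) = g v" by (simp add: assms(3))
    moreover have "length (drop (length v) (g (v @ [x]))) = 1" by (simp add: assms(2))
    ultimately show ?thesis by (metis One_nat_def length_0_conv length_Suc_conv)
  qed
  have edge: "tree_edge (g v) (g w)" if "tree_edge v w" for v w
    using that snoc by (auto simp: tree_edge_def)
  then have "tree_edge (g v) (g w) \<longleftrightarrow> tree_edge v w" for v w
    by (metis assms(1))
  moreover have "bij g" using assms(1) by (metis involuntory_imp_bij)
  moreover have "g [] = []" using assms(2) by (metis length_0_conv)
  ultimately show ?thesis using assms(1) by (auto simp: involutions_def tree_aut_def fun_eq_iff)
qed

lemma involution_comp:
  assumes "g \<in> involutions" "h \<in> involutions" "\<And>v. g (h v) = h (g v)"
  shows "g \<circ> h \<in> involutions"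
proof -
  have "g \<circ> h \<in> carrier tree_aut"
    using assms(1,2) monoid.m_closed[OF group.is_monoid[OF group_tree_aut]]
    by (force simp: involutions_def)
  moreover have "g (g v) = v" "h (h v) = v" for v
    using assms(1,2) by (simp_all add: involutions_def fun_eq_iff)
  then have "g \<circ> h \<circ> (g \<circ> h) = id"
    by (simp add: fun_eq_iff assms(3))
  ultimately show ?thesis by (simp add: involutions_def)
qed

lemma involution_gens [simp]:
  "gen_\<alpha> \<in> involutions" "gen_a \<in> involutions" "gen_\<beta> \<in> involutions"
  "gen_\<gamma> \<in> involutions" "gen_b \<in> involutions" "gen_c \<in> involutions"
  by (auto intro!: involutionI simp: length_gens take_gen_\<alpha> take_gen_a take_gen_\<beta>
      take_gen_\<gamma> take_gen_b take_gen_c)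

lemma involution_gens_comp [simp]:
  "gen_a \<circ> gen_\<alpha> \<in> involutions" "gen_b \<circ> gen_\<beta> \<in> involutions" "gen_c \<circ> gen_\<gamma> \<in> involutions"
  by (auto intro!: involution_comp simp: commute_\<alpha>a commute_\<beta>b commute_\<gamma>c)

lemma involution_carrier: "g \<in> involutions \<Longrightarrow> g \<in> carrier tree_aut"
  by (simp add: involutions_def)

lemma letter_action_gens [simp]:
  "letter_action gen_\<alpha> X1 = X2" "letter_action gen_\<alpha> X2 = X1"
  "letter_action gen_\<alpha> X3 = X4" "letter_action gen_\<alpha> X4 = X3"
  "letter_action gen_a X1 = X3" "letter_action gen_a X2 = X4"
  "letter_action gen_a X3 = X1" "letter_action gen_a X4 = X2"
  "letter_action gen_\<beta> x = x" "letter_action gen_\<gamma> x = x"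
  "letter_action gen_b x = x" "letter_action gen_c x = x"
  by (cases x; simp add: letter_action_def)+

lemma letter_action_gens_comp [simp]:
  "letter_action (gen_a \<circ> gen_\<alpha>) X1 = X4" "letter_action (gen_a \<circ> gen_\<alpha>) X2 = X3"
  "letter_action (gen_a \<circ> gen_\<alpha>) X3 = X2" "letter_action (gen_a \<circ> gen_\<alpha>) X4 = X1"
  "letter_action (gen_b \<circ> gen_\<beta>) x = x" "letter_action (gen_c \<circ> gen_\<gamma>) x = x"
  by (simp_all add: letter_action_comp involution_carrier)

lemma letter_section_gens [simp]:
  "letter_section gen_\<alpha> x = id" "letter_section gen_a x = id"
  "letter_section gen_\<beta> X1 = gen_\<alpha>" "letter_section gen_\<beta> X2 = gen_\<gamma>"
  "letter_section gen_\<beta> X3 = gen_\<alpha>" "letter_section gen_\<beta> X4 = gen_\<gamma>"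
  "letter_section gen_\<gamma> X1 = gen_\<beta>" "letter_section gen_\<gamma> X2 = id"
  "letter_section gen_\<gamma> X3 = id" "letter_section gen_\<gamma> X4 = gen_\<beta>"
  "letter_section gen_b X1 = gen_a \<circ> gen_\<alpha>" "letter_section gen_b X2 = gen_a \<circ> gen_\<alpha>"
  "letter_section gen_b X3 = gen_c" "letter_section gen_b X4 = gen_c"
  "letter_section gen_c X1 = gen_b \<circ> gen_\<beta>" "letter_section gen_c X2 = gen_b \<circ> gen_\<beta>"
  "letter_section gen_c X3 = gen_b" "letter_section gen_c X4 = gen_b"
  by (rule ext; cases x; simp add: letter_section_def)+

lemma letter_section_gens_comp [simp]:
  "letter_section (gen_a \<circ> gen_\<alpha>) x = id"
  "letter_section (gen_b \<circ> gen_\<beta>) X1 = gen_a"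
  "letter_section (gen_b \<circ> gen_\<beta>) X2 = gen_a \<circ> (gen_\<alpha> \<circ> gen_\<gamma>)"
  "letter_section (gen_b \<circ> gen_\<beta>) X3 = gen_c \<circ> gen_\<alpha>"
  "letter_section (gen_b \<circ> gen_\<beta>) X4 = gen_c \<circ> gen_\<gamma>"
  "letter_section (gen_c \<circ> gen_\<gamma>) X1 = gen_b"
  "letter_section (gen_c \<circ> gen_\<gamma>) X2 = gen_b \<circ> gen_\<beta>"
  "letter_section (gen_c \<circ> gen_\<gamma>) X3 = gen_b"
  "letter_section (gen_c \<circ> gen_\<gamma>) X4 = gen_b \<circ> gen_\<beta>"
  by (rule ext; cases x; simp add: letter_section_def)+

lemmas Gamma_defs = Gamma_A_def Gamma_B_def Gamma_C_def Gamma_A1_def Gamma_B1_def Gamma_C1_def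

lemma generated_products:
  "s \<in> S \<Longrightarrow> s \<in> generated S"
  "s \<in> S \<Longrightarrow> t \<in> S \<Longrightarrow> s \<circ> t \<in> generated S"
  "s \<in> S \<Longrightarrow> t \<in> S \<Longrightarrow> u \<in> S \<Longrightarrow> s \<circ> (t \<circ> u) \<in> generated S"
  by (intro generated_comp generate.incl; assumption)+

section \<open>One-letter sections of the six groups\<close>

lemma Gamma_A_sections:
  assumes "g \<in> Gamma_A"
  shows "letter_section g X1 \<in> Gamma_C" "letter_section g X2 \<in> Gamma_C1"
    "letter_section g X3 \<in> Gamma_A1" "letter_section g X4 \<in> Gamma_A"
proof -
  have S: "{gen_\<beta>, gen_\<gamma>, gen_b, gen_c} \<subseteq> involutions" by simp
  note g = assms[unfolded Gamma_A_def]
  show "letter_section g X1 \<in> Gamma_C" unfolding Gamma_defs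
    by (rule generated_sections[where Y = "{X1}", OF S _ g, THEN conjunct2]) (auto intro: generated_products)
  show "letter_section g X2 \<in> Gamma_C1" unfolding Gamma_defs
    by (rule generated_sections[where Y = "{X2}", OF S _ g, THEN conjunct2]) (auto intro: generated_products)
  show "letter_section g X3 \<in> Gamma_A1" unfolding Gamma_defs
    by (rule generated_sections[where Y = "{X3}", OF S _ g, THEN conjunct2]) (auto intro: generated_products)
  show "letter_section g X4 \<in> Gamma_A" unfolding Gamma_defs
    by (rule generated_sections[where Y = "{X4}", OF S _ g, THEN conjunct2]) (auto intro: generated_products)
qed

text \<open>\<alpha> and a have trivial sections, and those of \<gamma> and c are among id, \<beta>,
  b and b\<beta>, so one bound serves all letters.\<close>

lemma Gamma_B_sections:
  assumes "g \<in> Gamma_B"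
  shows "letter_section g x \<in> generated {gen_\<beta>, gen_b}"
proof -
  have "letter_section s y \<in> generated {gen_\<beta>, gen_b}"
    if "s \<in> {gen_\<alpha>, gen_\<gamma>, gen_a, gen_c}" for s y
    using that by (cases y) (auto intro: generated_products)
  then show ?thesis
    using generated_sections[of "{gen_\<alpha>, gen_\<gamma>, gen_a, gen_c}" UNIV] assms
    by (simp add: Gamma_B_def)
qed

lemma Gamma_C_sections:
  assumes "g \<in> Gamma_C"
  shows "letter_section g x \<in> Gamma_B"
proof -
  have "letter_section s y \<in> Gamma_B"
    if "s \<in> {gen_\<alpha>, gen_\<beta>, gen_a, gen_b}" for s y
    using that unfolding Gamma_B_def
    by (cases y) (auto intro: generated_products)
  then show ?thesis
    using generated_sections[of "{gen_\<alpha>, gen_\<beta>, gen_a, gen_b}" UNIV] assms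
    by (simp add: Gamma_B_def Gamma_C_def)
qed

text \<open>For this group and the next two, only one of the listed generators moves letters:
  \<alpha>, a and a\<alpha> respectively. The pairs of letters are its orbits.\<close>

lemma Gamma_A1_sections:
  assumes "g \<in> Gamma_A1"
  shows "x \<in> {X1, X2} \<Longrightarrow> letter_section g x \<in> generated {gen_a \<circ> gen_\<alpha>, gen_b \<circ> gen_\<beta>}"
    "x \<in> {X3, X4} \<Longrightarrow> letter_section g x \<in> generated {gen_b, gen_c}"
proof -
  have S: "{gen_\<alpha>, gen_b, gen_c} \<subseteq> involutions" by simp
  note g = assms[unfolded Gamma_A1_def]
  show "x \<in> {X1, X2} \<Longrightarrow> letter_section g x \<in> generated {gen_a \<circ> gen_\<alpha>, gen_b \<circ> gen_\<beta>}"
    by (rule generated_sections[where Y = "{X1, X2}", OF S _ g, THEN conjunct2]) (auto intro: generated_products)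
  show "x \<in> {X3, X4} \<Longrightarrow> letter_section g x \<in> generated {gen_b, gen_c}"
    by (rule generated_sections[where Y = "{X3, X4}", OF S _ g, THEN conjunct2]) (auto intro: generated_products)
qed

lemma Gamma_B1_sections:
  assumes "g \<in> Gamma_B1"
  shows "x \<in> {X1, X3} \<Longrightarrow> letter_section g x \<in> generated {gen_\<alpha>, gen_b}"
    "x \<in> {X2, X4} \<Longrightarrow> letter_section g x \<in> generated {gen_\<gamma>, gen_b \<circ> gen_\<beta>}"
proof -
  have S: "{gen_\<beta>, gen_a, gen_c \<circ> gen_\<gamma>} \<subseteq> involutions" by simp
  note g = assms[unfolded Gamma_B1_def]
  show "x \<in> {X1, X3} \<Longrightarrow> letter_section g x \<in> generated {gen_\<alpha>, gen_b}"
    by (rule generated_sections[where Y = "{X1, X3}", OF S _ g, THEN conjunct2]) (auto intro: generated_products)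
  show "x \<in> {X2, X4} \<Longrightarrow> letter_section g x \<in> generated {gen_\<gamma>, gen_b \<circ> gen_\<beta>}"
    by (rule generated_sections[where Y = "{X2, X4}", OF S _ g, THEN conjunct2]) (auto intro: generated_products)
qed

lemma Gamma_C1_sections:
  assumes "g \<in> Gamma_C1"
  shows "x \<in> {X1, X4} \<Longrightarrow> letter_section g x \<in> Gamma_B1"
    "x \<in> {X2, X3} \<Longrightarrow> letter_section g x \<in> Gamma_B"
proof -
  have S: "{gen_\<gamma>, gen_a \<circ> gen_\<alpha>, gen_b \<circ> gen_\<beta>} \<subseteq> involutions" by simp
  note g = assms[unfolded Gamma_C1_def]
  show "x \<in> {X1, X4} \<Longrightarrow> letter_section g x \<in> Gamma_B1" unfolding Gamma_defs
    by (rule generated_sections[where Y = "{X1, X4}", OF S _ g, THEN conjunct2]) (auto intro: generated_products)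
  show "x \<in> {X2, X3} \<Longrightarrow> letter_section g x \<in> Gamma_B" unfolding Gamma_defs
    by (rule generated_sections[where Y = "{X2, X3}", OF S _ g, THEN conjunct2]) (auto intro: generated_products)
qed

abbreviation nucleus :: "(word \<Rightarrow> word) set" where
  "nucleus \<equiv> Gamma_A \<union> Gamma_B \<union> Gamma_C \<union> Gamma_A1 \<union> Gamma_B1 \<union> Gamma_C1"

lemma generated_trans:
  assumes "\<And>s. s \<in> S \<Longrightarrow> s \<in> generated T" "T \<subseteq> involutions"
  shows "g \<in> generated S \<Longrightarrow> g \<in> generated T"
  using generated_subset_generated[of S T] assms by blast

text \<open>Each of these two-generator groups lies in two of the six groups. Which of the two is
  used later depends on the generator by which an element is multiplied.\<close>

lemma small_subgroups:
  "g \<in> generated {gen_\<beta>, gen_b} \<Longrightarrow> g \<in> Gamma_A"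
  "g \<in> generated {gen_\<beta>, gen_b} \<Longrightarrow> g \<in> Gamma_C"
  "g \<in> generated {gen_b, gen_c} \<Longrightarrow> g \<in> Gamma_A"
  "g \<in> generated {gen_b, gen_c} \<Longrightarrow> g \<in> Gamma_A1"
  "g \<in> generated {gen_a \<circ> gen_\<alpha>, gen_b \<circ> gen_\<beta>} \<Longrightarrow> g \<in> Gamma_C"
  "g \<in> generated {gen_a \<circ> gen_\<alpha>, gen_b \<circ> gen_\<beta>} \<Longrightarrow> g \<in> Gamma_C1"
  "g \<in> generated {gen_\<alpha>, gen_b} \<Longrightarrow> g \<in> Gamma_C"
  "g \<in> generated {gen_\<alpha>, gen_b} \<Longrightarrow> g \<in> Gamma_A1"
  "g \<in> generated {gen_\<gamma>, gen_b \<circ> gen_\<beta>} \<Longrightarrow> g \<in> Gamma_A"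
  "g \<in> generated {gen_\<gamma>, gen_b \<circ> gen_\<beta>} \<Longrightarrow> g \<in> Gamma_C1"
  unfolding Gamma_defs
  by (erule generated_trans[rotated -1]; auto intro: generated_products)+

lemma Gamma_gens_subset: "{gen_\<alpha>, gen_a, gen_\<beta>, gen_b, gen_\<gamma>, gen_c} \<subseteq> involutions"
  by simp

lemma nucleus_subset_Gamma: "nucleus \<subseteq> Gamma"
  unfolding Gamma_defs Gamma_def
  by (intro Un_least; rule generated_subset_generated[OF _ Gamma_gens_subset]) (auto intro: generated_products)

lemma Gamma_carrier: "g \<in> Gamma \<Longrightarrow> g \<in> carrier tree_aut"
  unfolding Gamma_def by (rule generated_carrier[OF Gamma_gens_subset])

lemma Gamma_gens [simp]:
  "gen_\<alpha> \<in> Gamma" "gen_a \<in> Gamma" "gen_\<beta> \<in> Gamma"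
  "gen_b \<in> Gamma" "gen_\<gamma> \<in> Gamma" "gen_c \<in> Gamma"
  by (auto simp: Gamma_def intro: generated_products)

lemma Gamma_comp [intro]: "g \<in> Gamma \<Longrightarrow> h \<in> Gamma \<Longrightarrow> g \<circ> h \<in> Gamma"
  unfolding Gamma_def by (rule generated_comp)

lemma Gamma_id [simp]: "id \<in> Gamma"
  unfolding Gamma_def by simp

lemma letter_section_Gamma:
  assumes "g \<in> Gamma"
  shows "letter_section g x \<in> Gamma"
proof -
  have "letter_section s y \<in> Gamma"
    if "s \<in> {gen_\<alpha>, gen_a, gen_\<beta>, gen_b, gen_\<gamma>, gen_c}" for s y
    using that unfolding Gamma_def by (cases y) (auto intro: generated_products)
  then show ?thesis
    using generated_sections[OF Gamma_gens_subset, of UNIV] assms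
    by (simp add: Gamma_def)
qed

lemma letter_section_nucleus:
  assumes "g \<in> nucleus"
  shows "letter_section g x \<in> nucleus"
proof -
  consider "g \<in> Gamma_A" | "g \<in> Gamma_B" | "g \<in> Gamma_C"
    | "g \<in> Gamma_A1" | "g \<in> Gamma_B1" | "g \<in> Gamma_C1"
    using assms by blast
  then show ?thesis
    by cases (cases x; auto dest: Gamma_A_sections Gamma_B_sections Gamma_C_sections
      Gamma_A1_sections Gamma_B1_sections Gamma_C1_sections small_subgroups)+
qed

text \<open>Having all sufficiently deep sections in the nucleus is encoded inductively, so that
  contraction can be proved by rule induction without bookkeeping of depths.\<close>

inductive_set absorbed :: "(word \<Rightarrow> word) set" where
  base: "g \<in> nucleus \<Longrightarrow> g \<in> absorbed"
| step: "g \<in> Gamma \<Longrightarrow> (\<And>x. letter_section g x \<in> absorbed) \<Longrightarrow> g \<in> absorbed"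

lemma absorbed_Gamma: "g \<in> absorbed \<Longrightarrow> g \<in> Gamma"
  using nucleus_subset_Gamma by (auto elim: absorbed.cases)

lemma tree_section_absorbed:
  assumes "g \<in> absorbed"
  shows "\<exists>n. \<forall>v. length v \<ge> n \<longrightarrow> tree_section g v \<in> nucleus"
  using assms
proof (induction rule: absorbed.induct)
  case (base g)
  have "tree_section g v \<in> nucleus" for v
    using base
  proof (induction v arbitrary: g)
    case (Cons x v)
    show ?case unfolding tree_section_Cons
      by (rule Cons.IH[OF letter_section_nucleus[OF Cons.prems]])
  qed simp
  then show ?case by blast
next
  case (step g)
  then obtain n where
    n: "\<And>x v. length v \<ge> n x \<Longrightarrow> tree_section (letter_section g x) v \<in> nucleus"
    by metis
  \<comment> \<open>The sum dominates the bound for each of the four letters, and the successor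
    accounts for the letter removed first.\<close>
  define m where "m = Suc (n X1 + n X2 + n X3 + n X4)"
  have "tree_section g w \<in> nucleus" if len: "length w \<ge> m" for w
  proof -
    obtain x v where w: "w = x # v" using len unfolding m_def by (cases w) auto
    have "length v \<ge> n x" using len w by (cases x) (auto simp: m_def)
    then show ?thesis using n w tree_section_Cons by metis
  qed
  then show ?case by blast
qed

lemma absorbed_letter_section:
  assumes "g \<in> absorbed"
  shows "letter_section g x \<in> absorbed"
  using assms
proof cases
  case base
  then show ?thesis by (intro absorbed.base letter_section_nucleus)
qed simp

text \<open>Sections of gs are sections of g multiplied on the right by sections of s. For a
  generator s these are again words in the generators, so right multiplication reduces to itself one
  level deeper.\<close>

lemma absorbed_comp_step:
  assumes "g \<in> Gamma" "s \<in> Gamma"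
    and "\<And>x. letter_section g (letter_action s x) \<circ> letter_section s x \<in> absorbed"
  shows "g \<circ> s \<in> absorbed"
  by (rule absorbed.step) (simp_all add: assms letter_section_comp Gamma_carrier Gamma_comp)

lemma absorbed_comp_letterwise:
  assumes "g \<in> Gamma" "s \<in> Gamma" "\<And>x. letter_action s x = x"
    and "letter_section g X1 \<circ> letter_section s X1 \<in> absorbed"
    and "letter_section g X2 \<circ> letter_section s X2 \<in> absorbed"
    and "letter_section g X3 \<circ> letter_section s X3 \<in> absorbed"
    and "letter_section g X4 \<circ> letter_section s X4 \<in> absorbed"
  shows "g \<circ> s \<in> absorbed"
proof (rule absorbed_comp_step[OF assms(1,2)])
  show "letter_section g (letter_action s x) \<circ> letter_section s x \<in> absorbed" for x
    using assms(4-7) by (cases x) (simp_all add: assms(3))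
qed

section \<open>Right multiplication of absorbed elements by the generators\<close>

lemma absorbed_comp_\<alpha>: "g \<in> absorbed \<Longrightarrow> g \<circ> gen_\<alpha> \<in> absorbed"
  by (rule absorbed_comp_step) (auto intro: absorbed_Gamma absorbed_letter_section)

lemma absorbed_comp_a: "g \<in> absorbed \<Longrightarrow> g \<circ> gen_a \<in> absorbed"
  by (rule absorbed_comp_step) (auto intro: absorbed_Gamma absorbed_letter_section)

lemma generated_comp_right:
  "h \<in> generated S \<Longrightarrow> s \<in> S \<Longrightarrow> h \<circ> s \<in> generated S"
  "h \<in> generated S \<Longrightarrow> s \<in> S \<Longrightarrow> t \<in> S \<Longrightarrow> h \<circ> (s \<circ> t) \<in> generated S"
  by (simp_all add: generated_comp generate.incl)

text \<open>If the generator belongs to the group of g, the product stays there. In most other cases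
  one letter leads back to the nucleus through the two-generator groups; \<open>Gamma_C\<close> with
  \<gamma> and \<open>Gamma_C1\<close> with \<beta> first reduce to cases for \<open>Gamma_B\<close>
  and \<open>Gamma_B1\<close>.\<close>

lemma absorbed_comp_\<beta>\<gamma>_nucleus:
  assumes "g \<in> nucleus"
  shows "g \<circ> gen_\<beta> \<in> absorbed \<and> g \<circ> gen_\<gamma> \<in> absorbed"
proof -
  have A: "h \<circ> gen_\<beta> \<in> Gamma_A" "h \<circ> gen_\<gamma> \<in> Gamma_A" if "h \<in> Gamma_A" for h
    using that by (simp_all add: Gamma_A_def generated_comp_right)
  have B: "h \<circ> gen_\<alpha> \<in> Gamma_B" "h \<circ> gen_\<gamma> \<in> Gamma_B" if "h \<in> Gamma_B" for h
    using that by (simp_all add: Gamma_B_def generated_comp_right)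
  have C: "h \<circ> gen_\<alpha> \<in> Gamma_C" "h \<circ> gen_\<beta> \<in> Gamma_C" if "h \<in> Gamma_C" for h
    using that by (simp_all add: Gamma_C_def generated_comp_right)
  have A1: "h \<circ> gen_\<alpha> \<in> Gamma_A1" if "h \<in> Gamma_A1" for h
    using that by (simp_all add: Gamma_A1_def generated_comp_right)
  have B1: "h \<circ> gen_\<beta> \<in> Gamma_B1" if "h \<in> Gamma_B1" for h
    using that by (simp_all add: Gamma_B1_def generated_comp_right)
  have C1: "h \<circ> gen_\<gamma> \<in> Gamma_C1" if "h \<in> Gamma_C1" for h
    using that by (simp_all add: Gamma_C1_def generated_comp_right)
  have G: "h \<in> Gamma" if "h \<in> nucleus" for h
    using that nucleus_subset_Gamma by blast
  note small = small_subgroups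
  have B\<beta>: "h \<circ> gen_\<beta> \<in> absorbed" if "h \<in> Gamma_B" for h
    using that Gamma_B_sections[OF that]
    by - (rule absorbed_comp_letterwise[OF G]; auto intro!: absorbed.base intro: A C small)
  have C\<gamma>: "h \<circ> gen_\<gamma> \<in> absorbed" if "h \<in> Gamma_C" for h
    using that Gamma_C_sections[OF that]
    by - (rule absorbed_comp_letterwise[OF G]; auto intro: absorbed.base B\<beta>)
  have A1\<beta>: "h \<circ> gen_\<beta> \<in> absorbed" if "h \<in> Gamma_A1" for h
    using that Gamma_A1_sections[OF that]
    by - (rule absorbed_comp_letterwise[OF G]; auto intro!: absorbed.base intro: A C C1 A1 small)
  have A1\<gamma>: "h \<circ> gen_\<gamma> \<in> absorbed" if "h \<in> Gamma_A1" for h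
    using that Gamma_A1_sections[OF that]
    by - (rule absorbed_comp_letterwise[OF G]; auto intro!: absorbed.base intro: A C C1 A1 small)
  have B1\<gamma>: "h \<circ> gen_\<gamma> \<in> absorbed" if "h \<in> Gamma_B1" for h
    using that Gamma_B1_sections[OF that]
    by - (rule absorbed_comp_letterwise[OF G]; auto intro!: absorbed.base intro: A C C1 A1 small)
  have C1\<beta>: "h \<circ> gen_\<beta> \<in> absorbed" if "h \<in> Gamma_C1" for h
    using that Gamma_C1_sections[OF that]
    by - (rule absorbed_comp_letterwise[OF G]; auto intro: absorbed.base B absorbed_comp_\<alpha> B1\<gamma>)
  consider "g \<in> Gamma_A" | "g \<in> Gamma_B" | "g \<in> Gamma_C"
    | "g \<in> Gamma_A1" | "g \<in> Gamma_B1" | "g \<in> Gamma_C1"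
    using assms by blast
  then show ?thesis
    by cases (blast intro: absorbed.base A B C A1 B1 C1 B\<beta> C\<gamma> A1\<beta> A1\<gamma> B1\<gamma> C1\<beta>)+
qed

text \<open>The sections of \<beta> and \<gamma> are \<alpha>, \<beta>, \<gamma> and id.
  Multiplication by \<alpha> is already settled, and \<beta> and \<gamma> are treated together
  because each occurs as a section of the other.\<close>

lemma absorbed_comp_\<beta>\<gamma>:
  assumes "g \<in> absorbed"
  shows "g \<circ> gen_\<beta> \<in> absorbed \<and> g \<circ> gen_\<gamma> \<in> absorbed"
  using assms
proof (induction rule: absorbed.induct)
  case (base g)
  then show ?case by (rule absorbed_comp_\<beta>\<gamma>_nucleus)
next
  case (step g)
  then have "letter_section g x \<circ> gen_\<alpha> \<in> absorbed" for x
    by (blast intro: absorbed_comp_\<alpha>)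
  moreover have "letter_section g x \<circ> gen_\<beta> \<in> absorbed"
    "letter_section g x \<circ> gen_\<gamma> \<in> absorbed" for x
    using step.IH[of x] by (simp_all add: comp_def)
  ultimately show ?case using step.hyps
    by - (rule conjI; rule absorbed_comp_letterwise; simp)
qed

lemmas absorbed_comp_\<beta> = absorbed_comp_\<beta>\<gamma>[THEN conjunct1]
lemmas absorbed_comp_\<gamma> = absorbed_comp_\<beta>\<gamma>[THEN conjunct2]

lemma absorbed_comp_bc_nucleus:
  assumes "g \<in> nucleus"
  shows "g \<circ> gen_b \<in> absorbed \<and> g \<circ> gen_c \<in> absorbed"
proof -
  have A: "h \<circ> gen_b \<in> Gamma_A" "h \<circ> gen_c \<in> Gamma_A" if "h \<in> Gamma_A" for h
    using that by (simp_all add: Gamma_A_def generated_comp_right)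
  have B: "h \<circ> gen_c \<in> Gamma_B" if "h \<in> Gamma_B" for h
    using that by (simp_all add: Gamma_B_def generated_comp_right)
  have C: "h \<circ> gen_b \<in> Gamma_C" "h \<circ> (gen_a \<circ> gen_\<alpha>) \<in> Gamma_C" if "h \<in> Gamma_C" for h
    using that by (simp_all add: Gamma_C_def generated_comp_right)
  have A1: "h \<circ> gen_b \<in> Gamma_A1" "h \<circ> gen_c \<in> Gamma_A1" if "h \<in> Gamma_A1" for h
    using that by (simp_all add: Gamma_A1_def generated_comp_right)
  have B1: "h \<circ> (gen_c \<circ> gen_\<gamma>) \<in> Gamma_B1" if "h \<in> Gamma_B1" for h
    using that by (simp_all add: Gamma_B1_def generated_comp_right)
  have C1: "h \<circ> (gen_a \<circ> gen_\<alpha>) \<in> Gamma_C1" "h \<circ> (gen_b \<circ> gen_\<beta>) \<in> Gamma_C1"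
    if "h \<in> Gamma_C1" for h
    using that by (simp_all add: Gamma_C1_def generated_comp_right)
  have G: "h \<in> Gamma" if "h \<in> nucleus" for h
    using that nucleus_subset_Gamma by blast
  note small = small_subgroups
  have b\<beta>: "h \<circ> (gen_b \<circ> gen_\<beta>) \<in> absorbed" if "h \<circ> gen_b \<in> absorbed" for h
    using absorbed_comp_\<beta>[OF that] by (simp only: comp_assoc)
  have Bb: "h \<circ> gen_b \<in> absorbed" if "h \<in> Gamma_B" for h
    using that Gamma_B_sections[OF that]
    by - (rule absorbed_comp_letterwise[OF G]; auto intro!: absorbed.base intro: A C small)
  have B1b: "h \<circ> gen_b \<in> absorbed" if "h \<in> Gamma_B1" for h
    using that Gamma_B1_sections[OF that]
    by - (rule absorbed_comp_letterwise[OF G]; auto intro!: absorbed.base intro: A C A1 C1 small)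
  have C1b: "h \<circ> gen_b \<in> absorbed" if "h \<in> Gamma_C1" for h
  proof -
    \<comment> \<open>The generating set of \<open>Gamma_C1\<close> has b\<beta> in place of b; the
      surplus \<beta> is removed by the result for right multiplication by \<beta>. For
      \<open>Gamma_B1\<close> and c the same is done with \<gamma>.\<close>
    have "h \<circ> gen_b = h \<circ> (gen_b \<circ> gen_\<beta>) \<circ> gen_\<beta>" by (simp add: fun_eq_iff)
    then show ?thesis using absorbed_comp_\<beta> absorbed.base C1(2)[OF that] by (metis UnCI)
  qed
  have B1c: "h \<circ> gen_c \<in> absorbed" if "h \<in> Gamma_B1" for h
  proof -
    have "h \<circ> gen_c = h \<circ> (gen_c \<circ> gen_\<gamma>) \<circ> gen_\<gamma>" by (simp add: fun_eq_iff)
    then show ?thesis using absorbed_comp_\<gamma> absorbed.base B1[OF that] by (metis UnCI)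
  qed
  \<comment> \<open>The sections of h lie in \<open>Gamma_B\<close> and get multiplied by b\<beta>
    or b, so the case of c follows from that of b.\<close>
  have Cc: "h \<circ> gen_c \<in> absorbed" if "h \<in> Gamma_C" for h
    using that Gamma_C_sections[OF that]
    by - (rule absorbed_comp_letterwise[OF G]; auto intro: b\<beta> Bb)
  have C1c: "h \<circ> gen_c \<in> absorbed" if "h \<in> Gamma_C1" for h
    using that Gamma_C1_sections[OF that]
    by - (rule absorbed_comp_letterwise[OF G]; auto intro: b\<beta> Bb B1b)
  consider "g \<in> Gamma_A" | "g \<in> Gamma_B" | "g \<in> Gamma_C"
    | "g \<in> Gamma_A1" | "g \<in> Gamma_B1" | "g \<in> Gamma_C1"
    using assms by blast
  then show ?thesis
    by cases (blast intro: absorbed.base A B C A1 Bb B1b C1b B1c Cc C1c)+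
qed

lemma absorbed_comp_bc:
  assumes "g \<in> absorbed"
  shows "g \<circ> gen_b \<in> absorbed \<and> g \<circ> gen_c \<in> absorbed"
  using assms
proof (induction rule: absorbed.induct)
  case (base g)
  then show ?case by (rule absorbed_comp_bc_nucleus)
next
  case (step g)
  have "letter_section g x \<circ> (gen_a \<circ> gen_\<alpha>) \<in> absorbed" for x
    using absorbed_comp_\<alpha>[OF absorbed_comp_a[OF step(2)]] by (simp only: comp_assoc)
  moreover have "letter_section g x \<circ> (gen_b \<circ> gen_\<beta>) \<in> absorbed" for x
    using absorbed_comp_\<beta>[OF step.IH[THEN conjunct1]] by (simp add: comp_def)
  moreover have "letter_section g x \<circ> gen_b \<in> absorbed"
    "letter_section g x \<circ> gen_c \<in> absorbed" for x
    using step.IH[of x] by (simp_all add: comp_def)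
  ultimately show ?case using step(1)
    by - (rule conjI; rule absorbed_comp_letterwise; simp)
qed

lemma Gamma_absorbed:
  assumes "g \<in> Gamma"
  shows "g \<in> absorbed"
proof -
  \<comment> \<open>The induction peels generators off the left of g, whereas absorption is known
    for right multiplication; each peeled generator is therefore shifted onto the arbitrary left
    factor h.\<close>
  have "h \<circ> g \<in> absorbed" if "h \<in> absorbed" for h
    using Gamma_gens_subset assms[unfolded Gamma_def] that
  proof (induction arbitrary: h rule: generated_induct)
    case id
    then show ?case by (simp only: comp_id)
  next
    case (comp s k)
    from comp.hyps(1) have "h \<circ> s \<in> absorbed"
      by (elim insertE emptyE) (simp_all only: comp.prems absorbed_comp_\<alpha> absorbed_comp_a
        absorbed_comp_\<beta> absorbed_comp_\<gamma> absorbed_comp_bc)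
    then show ?case using comp.IH[of "h \<circ> s"] by (simp only: comp_assoc)
  qed
  moreover have "id \<in> absorbed" by (rule absorbed.base) (simp add: Gamma_A_def)
  ultimately have "id \<circ> g \<in> absorbed" by blast
  then show ?thesis by (simp only: id_comp)
qed

section \<open>Finiteness of the nucleus\<close>

lemma finite_generated_subset:
  assumes "finite (generated T)" "\<And>s. s \<in> S \<Longrightarrow> s \<in> generated T" "T \<subseteq> involutions"
  shows "finite (generated S)"
  using finite_subset[OF generated_subset_generated[of S T]] assms by blast

lemma finite_generated_commute:
  assumes "finite (generated S)" "finite (generated T)" "S \<subseteq> involutions" "T \<subseteq> involutions"
    and "\<And>s t v. s \<in> S \<Longrightarrow> t \<in> T \<Longrightarrow> s (t v) = t (s v)"
  shows "finite (generated (S \<union> T))"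
proof (rule finite_generated_Un[OF assms(3,4,1,2)])
  fix s t assume st: "s \<in> S" "t \<in> T"
  then have "t (t v) = v" for v using assms(4) by (auto simp: involutions_def fun_eq_iff)
  then have "t (s (t v)) = s v" for v using assms(5)[OF st] by metis
  then have "t \<circ> s \<circ> t = s" by (simp add: fun_eq_iff)
  then show "t \<circ> s \<circ> t \<in> generated S" using st by (simp add: generate.incl)
qed

lemma finite_dihedral_subgroups:
  "finite (generated {gen_\<alpha>, gen_\<gamma>})" "finite (generated {gen_\<alpha>, gen_\<beta>})"
  "finite (generated {gen_\<beta>, gen_\<gamma>})" "finite (generated {gen_a, gen_b})"
  "finite (generated {gen_a, gen_c})" "finite (generated {gen_b, gen_c})"
  using finite_generated_pair[of gen_\<alpha> gen_\<gamma> 4] finite_generated_pair[of gen_\<alpha> gen_\<beta> 8]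
    finite_generated_pair[of gen_\<beta> gen_\<gamma> 8] finite_generated_pair[of gen_a gen_b 8]
    finite_generated_pair[of gen_a gen_c 4] finite_generated_pair[of gen_b gen_c 4]
  by (simp_all add: fun_eq_iff pow_\<alpha>\<gamma> pow_\<alpha>\<beta> pow_\<beta>\<gamma>_\<gamma>\<beta> pow_ab pow_ac pow_bc)

text \<open>Each of \<alpha> and \<beta> commutes with each of a and b, so two finite dihedral
  groups commute elementwise.\<close>

lemma finite_Gamma_C: "finite Gamma_C"
proof -
  have "finite (generated ({gen_\<alpha>, gen_\<beta>} \<union> {gen_a, gen_b}))"
    by (rule finite_generated_commute) (auto simp: finite_dihedral_subgroups commute_\<alpha>a commute_\<alpha>b commute_\<beta>a commute_\<beta>b)
  then show ?thesis by (simp only: Gamma_C_def Un_insert_left Un_empty_left)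
qed

lemma finite_Gamma_B: "finite Gamma_B"
proof -
  have "gen_a \<circ> gen_\<gamma> \<circ> gen_a = gen_\<alpha> \<circ> (gen_\<gamma> \<circ> gen_\<alpha>)"
    "gen_a \<circ> gen_\<alpha> \<circ> gen_a = gen_\<alpha>" "gen_c \<circ> gen_\<alpha> \<circ> gen_c = gen_\<alpha>"
    "gen_c \<circ> gen_\<gamma> \<circ> gen_c = gen_\<gamma>"
    by (simp_all add: fun_eq_iff commute_\<alpha>a conj_\<gamma>a commute_\<alpha>c commute_\<gamma>c)
  then have "finite (generated ({gen_\<alpha>, gen_\<gamma>} \<union> {gen_a, gen_c}))"
    by (intro finite_generated_Un) (auto simp: finite_dihedral_subgroups intro: generated_products)
  then show ?thesis by (simp only: Gamma_B_def Un_insert_left Un_empty_left)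
qed

lemma finite_Gamma_A: "finite Gamma_A"
proof -
  have "gen_b \<circ> gen_\<gamma> \<circ> gen_b = gen_\<beta> \<circ> (gen_\<gamma> \<circ> gen_\<beta>)"
    "gen_c \<circ> gen_\<beta> \<circ> gen_c = gen_\<gamma> \<circ> (gen_\<beta> \<circ> gen_\<gamma>)"
    "gen_b \<circ> gen_\<beta> \<circ> gen_b = gen_\<beta>" "gen_c \<circ> gen_\<gamma> \<circ> gen_c = gen_\<gamma>"
    by (simp_all add: fun_eq_iff conj_b\<gamma>_c\<beta> commute_\<beta>b commute_\<gamma>c)
  then have "finite (generated ({gen_\<beta>, gen_\<gamma>} \<union> {gen_b, gen_c}))"
    by (intro finite_generated_Un) (auto simp: finite_dihedral_subgroups intro: generated_products)
  then show ?thesis by (simp only: Gamma_A_def Un_insert_left Un_empty_left)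
qed

lemma finite_Gamma_A1: "finite Gamma_A1"
proof -
  have "finite (generated {gen_\<alpha>})"
    by (rule finite_generated_subset[OF finite_dihedral_subgroups(1)]) (auto intro: generated_products)
  then have "finite (generated ({gen_\<alpha>} \<union> {gen_b, gen_c}))"
    by (intro finite_generated_commute) (auto simp: finite_dihedral_subgroups commute_\<alpha>b commute_\<alpha>c)
  then show ?thesis by (simp only: Gamma_A1_def Un_insert_left Un_empty_left)
qed

text \<open>c\<gamma> commutes with \<beta> and a. The two commuting subgroups are finite because
  they lie in \<open>Gamma_A\<close> and \<open>Gamma_C\<close>.\<close>

lemma finite_Gamma_B1: "finite Gamma_B1"
proof -
  have "finite (generated {gen_\<beta>, gen_a})"
    by (rule finite_generated_subset[OF finite_Gamma_C[unfolded Gamma_C_def]])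
      (auto intro: generated_products)
  moreover have "finite (generated {gen_c \<circ> gen_\<gamma>})"
    by (rule finite_generated_subset[OF finite_Gamma_A[unfolded Gamma_A_def]])
      (auto intro: generated_products)
  ultimately have "finite (generated ({gen_\<beta>, gen_a} \<union> {gen_c \<circ> gen_\<gamma>}))"
    by (intro finite_generated_commute) (auto simp: commute_c\<gamma>a commute_c\<gamma>\<beta>)
  then show ?thesis by (simp only: Gamma_B1_def Un_insert_left Un_empty_left)
qed

lemma finite_Gamma_C1: "finite Gamma_C1"
proof -
  have "finite (generated {gen_\<gamma>})"
    by (rule finite_generated_subset[OF finite_dihedral_subgroups(1)]) (auto intro: generated_products)
  moreover have "finite (generated {gen_a \<circ> gen_\<alpha>, gen_b \<circ> gen_\<beta>})"
    by (rule finite_generated_subset[OF finite_Gamma_C[unfolded Gamma_C_def]])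
      (auto intro: generated_products)
  ultimately have "finite (generated ({gen_\<gamma>} \<union> {gen_a \<circ> gen_\<alpha>, gen_b \<circ> gen_\<beta>}))"
    by (intro finite_generated_commute) (auto simp: commute_\<gamma>a\<alpha> commute_b\<beta>\<gamma>)
  then show ?thesis by (simp only: Gamma_C1_def Un_insert_left Un_empty_left)
qed

lemma finite_nucleus: "finite nucleus"
  by (simp add: finite_Gamma_A finite_Gamma_B finite_Gamma_C
      finite_Gamma_A1 finite_Gamma_B1 finite_Gamma_C1)

section \<open>Minimality\<close>

text \<open>Conjugation by \<alpha>, a or a\<alpha> transports a section from the letter 2, 3 or 4
  to the letter 1. This supplies the lifts that no generator or product of two provides
  directly.\<close>

lemma section_conj:
  "letter_action (gen_\<alpha> \<circ> (gen_\<beta> \<circ> gen_\<alpha>)) X1 = X1"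
  "letter_section (gen_\<alpha> \<circ> (gen_\<beta> \<circ> gen_\<alpha>)) X1 = gen_\<gamma>"
  "letter_action (gen_a \<circ> (gen_b \<circ> gen_a)) X1 = X1"
  "letter_section (gen_a \<circ> (gen_b \<circ> gen_a)) X1 = gen_c"
  "letter_action ((gen_a \<circ> gen_\<alpha>) \<circ> ((gen_b \<circ> gen_\<beta>) \<circ> (gen_a \<circ> gen_\<alpha>))) X1 = X1"
  "letter_section ((gen_a \<circ> gen_\<alpha>) \<circ> ((gen_b \<circ> gen_\<beta>) \<circ> (gen_a \<circ> gen_\<alpha>))) X1 = gen_c \<circ> gen_\<gamma>"
  by (simp_all add: letter_action_def letter_section_def fun_eq_iff)

definition liftable :: "(word \<Rightarrow> word) set \<Rightarrow> letter \<Rightarrow> (word \<Rightarrow> word) \<Rightarrow> bool" where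
  "liftable S x t \<longleftrightarrow> (\<exists>g\<in>generated S. letter_action g x = x \<and> letter_section g x = t)"

lemma liftableI:
  "letter_section g x = t \<Longrightarrow> letter_action g x = x \<Longrightarrow> g \<in> generated S \<Longrightarrow> liftable S x t"
  by (auto simp: liftable_def)

lemma liftable_generated:
  assumes "S \<subseteq> involutions" "T \<subseteq> involutions" "h \<in> generated T"
    and "\<And>t. t \<in> T \<Longrightarrow> liftable S x t"
  shows "\<exists>g\<in>generated S. letter_section g x = h"
  using generated_lift[OF assms(1,2) _ assms(3), of x] assms(4) by (auto simp: liftable_def)

text \<open>\<open>Gamma_A\<close> maps onto \<open>Gamma_C\<close>, \<open>Gamma_C1\<close>,
  \<open>Gamma_A1\<close> and \<open>Gamma_A\<close> by sections at 1, 2, 3, 4. At the letter 1,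
  \<open>Gamma_C\<close> yields \<open>Gamma_B\<close> and \<open>Gamma_C1\<close> yields
  \<open>Gamma_B1\<close>.\<close>

lemma nucleus_letter_section:
  assumes "h \<in> nucleus"
  shows "\<exists>g\<in>nucleus. \<exists>x. letter_section g x = h"
proof -
  let ?A = "{gen_\<beta>, gen_\<gamma>, gen_b, gen_c}"
  let ?C = "{gen_\<alpha>, gen_\<beta>, gen_a, gen_b}"
  let ?C1 = "{gen_\<gamma>, gen_a \<circ> gen_\<alpha>, gen_b \<circ> gen_\<beta>}"
  have "liftable ?A X4 gen_\<beta>" by (rule liftableI[of gen_\<gamma>]) (auto intro: generated_products)
  moreover have "liftable ?A X4 gen_\<gamma>" by (rule liftableI[of gen_\<beta>]) (auto intro: generated_products)
  moreover have "liftable ?A X4 gen_b" by (rule liftableI[of gen_c]) (auto intro: generated_products)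
  moreover have "liftable ?A X4 gen_c" by (rule liftableI[of gen_b]) (auto intro: generated_products)
  ultimately have A: "\<exists>g\<in>Gamma_A. letter_section g X4 = h" if "h \<in> Gamma_A"
    using that unfolding Gamma_A_def by (intro liftable_generated) auto
  have "liftable ?A X1 gen_\<alpha>" by (rule liftableI[of gen_\<beta>]) (auto intro: generated_products)
  moreover have "liftable ?A X1 gen_\<beta>" by (rule liftableI[of gen_\<gamma>]) (auto intro: generated_products)
  moreover have "liftable ?A X1 gen_a"
    by (rule liftableI[of "gen_b \<circ> gen_\<beta>"]) (auto intro: generated_products)
  moreover have "liftable ?A X1 gen_b"
    by (rule liftableI[of "gen_c \<circ> gen_\<gamma>"]) (auto intro: generated_products)
  ultimately have C: "\<exists>g\<in>Gamma_A. letter_section g X1 = h" if "h \<in> Gamma_C"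
    using that unfolding Gamma_A_def Gamma_C_def by (intro liftable_generated) auto
  have "liftable ?A X2 gen_\<gamma>" by (rule liftableI[of gen_\<beta>]) (auto intro: generated_products)
  moreover have "liftable ?A X2 (gen_a \<circ> gen_\<alpha>)"
    by (rule liftableI[of gen_b]) (auto intro: generated_products)
  moreover have "liftable ?A X2 (gen_b \<circ> gen_\<beta>)"
    by (rule liftableI[of gen_c]) (auto intro: generated_products)
  ultimately have C1: "\<exists>g\<in>Gamma_A. letter_section g X2 = h" if "h \<in> Gamma_C1"
    using that unfolding Gamma_A_def Gamma_C1_def by (intro liftable_generated) auto
  have "liftable ?A X3 gen_\<alpha>" by (rule liftableI[of gen_\<beta>]) (auto intro: generated_products)
  moreover have "liftable ?A X3 gen_b" by (rule liftableI[of gen_c]) (auto intro: generated_products)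
  moreover have "liftable ?A X3 gen_c" by (rule liftableI[of gen_b]) (auto intro: generated_products)
  ultimately have A1: "\<exists>g\<in>Gamma_A. letter_section g X3 = h" if "h \<in> Gamma_A1"
    using that unfolding Gamma_A_def Gamma_A1_def by (intro liftable_generated) auto
  have "liftable ?C X1 gen_\<alpha>" by (rule liftableI[of gen_\<beta>]) (auto intro: generated_products)
  moreover have "liftable ?C X1 gen_\<gamma>"
    by (rule liftableI[OF section_conj(2,1)]) (auto intro: generated_products)
  moreover have "liftable ?C X1 gen_a"
    by (rule liftableI[of "gen_b \<circ> gen_\<beta>"]) (auto intro: generated_products)
  moreover have "liftable ?C X1 gen_c"
    by (rule liftableI[OF section_conj(4,3)]) (auto intro: generated_products)
  ultimately have B: "\<exists>g\<in>Gamma_C. letter_section g X1 = h" if "h \<in> Gamma_B"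
    using that unfolding Gamma_C_def Gamma_B_def by (intro liftable_generated) auto
  have "liftable ?C1 X1 gen_\<beta>" by (rule liftableI[of gen_\<gamma>]) (auto intro: generated_products)
  moreover have "liftable ?C1 X1 gen_a"
    by (rule liftableI[of "gen_b \<circ> gen_\<beta>"]) (auto intro: generated_products)
  moreover have "liftable ?C1 X1 (gen_c \<circ> gen_\<gamma>)"
    by (rule liftableI[OF section_conj(6,5)]) (rule generated_products; simp)
  ultimately have B1: "\<exists>g\<in>Gamma_C1. letter_section g X1 = h" if "h \<in> Gamma_B1"
    using that unfolding Gamma_C1_def Gamma_B1_def by (intro liftable_generated) auto
  show ?thesis using assms A C1 A1 C B B1 by blast
qed

lemma nucleus_tree_section:
  assumes "h \<in> nucleus"
  shows "\<exists>g\<in>nucleus. \<exists>v. length v = n \<and> tree_section g v = h"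
  using assms
proof (induction n arbitrary: h)
  case 0
  then show ?case by (metis list.size(3) tree_section.simps(1))
next
  case (Suc n)
  obtain k x where k: "k \<in> nucleus" "letter_section k x = h"
    using nucleus_letter_section[OF Suc.prems] by blast
  obtain g v where g: "g \<in> nucleus" "length v = n" "tree_section g v = k"
    using Suc.IH[OF k(1)] by blast
  have "tree_section g (v @ [x]) = h"
    using g k by (simp only: tree_section_append tree_section_Cons) (simp only: tree_section.simps)
  then show ?case using g by (metis length_append_singleton)
qed

text \<open>Finiteness of the nucleus gives one depth beyond which the sections of all its elements
  lie in N, and every h in the nucleus is such a section at exactly that depth.\<close>

lemma nucleus_minimal:
  assumes "absorbing Gamma N"
  shows "nucleus \<subseteq> N"
proof
  fix h assume h: "h \<in> nucleus"
  have "\<forall>g\<in>nucleus. \<exists>n. \<forall>v. length v \<ge> n \<longrightarrow> tree_section g v \<in> N"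
    using assms nucleus_subset_Gamma unfolding absorbing_def by blast
  then obtain n where
    n: "\<And>g v. g \<in> nucleus \<Longrightarrow> length v \<ge> n g \<Longrightarrow> tree_section g v \<in> N"
    by metis
  obtain g v where "g \<in> nucleus" "length v = Max (n ` nucleus)" "tree_section g v = h"
    using nucleus_tree_section[OF h] by blast
  moreover have "n g \<le> Max (n ` nucleus)"
    using finite_nucleus \<open>g \<in> nucleus\<close> by (intro Max_ge finite_imageI imageI)
  ultimately show "h \<in> N" using n by metis
qed

theorem proposition5p1:
  shows "is_nucleus Gamma
    (Gamma_A \<union> Gamma_B \<union> Gamma_C \<union> Gamma_A1 \<union> Gamma_B1 \<union> Gamma_C1)"
proof -
  have "subgroup Gamma tree_aut"
    unfolding Gamma_def using involution_carrier Gamma_gens_subset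
    by (intro group.generate_is_subgroup[OF group_tree_aut]) blast
  moreover have "tree_section g v \<in> Gamma" if "g \<in> Gamma" for g v
    using that
  proof (induction v arbitrary: g)
    case (Cons x v)
    show ?case unfolding tree_section_Cons
      by (rule Cons.IH[OF letter_section_Gamma[OF Cons.prems]])
  qed simp
  ultimately have "self_similar Gamma" by (simp add: self_similar_def)
  moreover have "absorbing Gamma nucleus"
    using nucleus_subset_Gamma Gamma_absorbed tree_section_absorbed
    unfolding absorbing_def by blast
  ultimately show ?thesis
    unfolding is_nucleus_def contracting_def
    by (intro conjI exI[of _ nucleus] allI impI finite_nucleus nucleus_minimal)
qed

end
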